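(* Let $m\ge 4$ be an integer. Monomial curves in $\mathbb{A}^m$ may have arbitrarily large Markov complexity: for every $d\in\mathbb{N}$ there exists a monomial curve $\mathcal{A}=(a_1,\dots,a_m)$ in $\mathbb{A}^m$ whose Markov complexity satisfies $m(\mathcal{A})>d$.
   Context: A monomial curve in $\mathbb{A}^n$ is given by $n$ distinct positive integers $\mathcal{A}=(a_1,\dots,a_n)$, regarded as a $1\times n$ integer matrix $A$. For an integer matrix $M$ with $N$ columns and nonnegative entries such that $\ker_{\mathbb{Z}}(M)\cap\mathbb{N}^N=\{0\}$ (here $0\in\mathbb{N}$), a Markov basis of $M$ is a finite subset $\mathcal{M}\subset\ker_{\mathbb{Z}}(M)$ such that for all $w,u\in\mathbb{N}^N$ with $w-u\in\ker_{\mathbb{Z}}(M)$ there is a finite sequence $v_1,\dots,v_s$ of elements which up to sign belong to $\mathcal{M}$ (repetitions allowed), with $w-u=\sum_{i=1}^s v_i$ and $w-\sum_{i=1}^p v_i\in\mathbb{N}^N$ for all $1\le p\le s$. A Markov basis is minimal if no proper subset of it is a Markov basis. The universal Markov basis of $M$ is the union of all minimal Markov bases of $M$, where elements differing by a sign are identified. For $r\ge 2$ the $r$-th Lawrence lifting $A^{(r)}$ of a $k\times n$ matrix $A$ is the $(rk+n)\times rn$ matrix whose first $rk$ rows form the block diagonal matrix with $r$ diagonal blocks equal to $A$, and whose last $n$ rows are $(I_n\ I_n\ \cdots\ I_n)$. An element of $\ker_{\mathbb{Z}}(A^{(r)})$ is identified with an $r\times n$ integer matrix each of whose rows lies in $\ker_{\mathbb{Z}}(A)$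 and whose rows sum to zero. The type of such an element is the number of its nonzero rows. The Markov complexity $m(\mathcal{A})$ is the largest type of any element of the universal Markov basis of $A^{(r)}$, as $r\ge2$ varies. (The integer $m$ and the function $m(\cdot)$ are unrelated.) *)

theory Defs
  imports
    "Jordan_Normal_Form.Matrix_Kernel"
    "HOL-Library.Extended_Nat"
begin

section \<open>Markov bases of integer matrices\<close>

definition nonneg_vecs :: "nat \<Rightarrow> int vec set" where
  "nonneg_vecs N = {u \<in> carrier_vec N. \<forall>j<N. 0 \<le> u $ j}"

text \<open>
  JNF vectors carry their dimension at run time, so \<open>sum_list\<close> is not available for them; the
  dimension is needed for the empty sum.
\<close>

definition vec_sum :: "nat \<Rightarrow> int vec list \<Rightarrow> int vec" where
  "vec_sum N vs = foldr (+) vs (0\<^sub>v N)"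

text \<open>
  Markov bases are only considered for matrices \<open>M\<close> with nonnegative entries whose kernel meets
  the nonnegative orthant in \<open>0\<close> only. This is not repeated in the definition: it holds for every
  Lawrence lifting used below, see \<open>lawrence_lifting_nonneg\<close> and \<open>lawrence_lifting_pointed\<close>.
  The sequence \<open>vs\<close> may be empty, which covers the case \<open>w = u\<close>.
\<close>

definition markov_basis :: "int mat \<Rightarrow> int vec set \<Rightarrow> bool" where
  "markov_basis M B \<longleftrightarrow>
     finite B \<and> B \<subseteq> mat_kernel M \<and>
     (\<forall>w \<in> nonneg_vecs (dim_col M). \<forall>u \<in> nonneg_vecs (dim_col M).
        w - u \<in> mat_kernel M \<longrightarrow>
        (\<exists>vs. (\<forall>v \<in> set vs. v \<in> B \<or> - v \<in> B) \<and>
              w - u = vec_sum (dim_col M) vs \<and>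
              (\<forall>p \<in> {1..length vs}.
                 w - vec_sum (dim_col M) (take p vs) \<in> nonneg_vecs (dim_col M))))"

definition minimal_markov_basis :: "int mat \<Rightarrow> int vec set \<Rightarrow> bool" where
  "minimal_markov_basis M B \<longleftrightarrow>
     markov_basis M B \<and> (\<forall>B'. B' \<subset> B \<longrightarrow> \<not> markov_basis M B')"

text \<open>
  Changing the sign of an element of a minimal Markov basis yields a minimal Markov basis, so this
  union is closed under negation. It represents the universal Markov basis, in which \<open>v\<close> and
  \<open>- v\<close> are identified, by listing both representatives; the type of an element does not depend on
  the choice.
\<close>

definition universal_markov_basis :: "int mat \<Rightarrow> int vec set" where
  "universal_markov_basis M = \<Union>{B. minimal_markov_basis M B}"


section \<open>Lawrence liftings\<close>

definition lawrence_lifting :: "nat \<Rightarrow> int mat \<Rightarrow> int mat" where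
  "lawrence_lifting r A =
     diag_block_mat (replicate r A) @\<^sub>r
     mat (dim_col A) (r * dim_col A) (\<lambda>(i, j). if j mod dim_col A = i then 1 else 0)"

text \<open>
  Row \<open>i\<close> of the \<open>r \<times> n\<close> matrix identified with a vector of length \<open>r * n\<close>; the identification is
  justified by \<open>lawrence_lifting_kernel\<close>.
\<close>

definition block_row :: "nat \<Rightarrow> int vec \<Rightarrow> nat \<Rightarrow> int vec" where
  "block_row n v i = vec n (\<lambda>j. v $ (i * n + j))"

definition lawrence_type :: "nat \<Rightarrow> nat \<Rightarrow> int vec \<Rightarrow> nat" where
  "lawrence_type r n v = card {i. i < r \<and> block_row n v i \<noteq> 0\<^sub>v n}"


section \<open>Monomial curves and Markov complexity\<close>

definition monomial_curve :: "nat \<Rightarrow> int list \<Rightarrow> bool" where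
  "monomial_curve n as \<longleftrightarrow> length as = n \<and> distinct as \<and> (\<forall>a \<in> set as. 0 < a)"

definition curve_matrix :: "int list \<Rightarrow> int mat" where
  "curve_matrix as = mat_of_rows_list (length as) [as]"

text \<open>
  The supremum in \<^typ>\<open>enat\<close> is the largest type whenever the types are bounded, and \<open>\<infinity>\<close> otherwise.
\<close>

definition markov_complexity :: "int list \<Rightarrow> enat" where
  "markov_complexity as =
     (SUP r \<in> {2..}. SUP v \<in> universal_markov_basis (lawrence_lifting r (curve_matrix as)).
        enat (lawrence_type r (length as) v))"


section \<open>The kernel of a Lawrence lifting\<close>

lemma diag_block_mat_replicate_carrier:
  assumes "A \<in> carrier_mat k n"
  shows "diag_block_mat (replicate r A) \<in> carrier_mat (r * k) (r * n)"
  using assms by (intro carrier_matI) (auto simp: dim_diag_block_mat sum_list_replicate)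

lemma lawrence_lifting_carrier:
  assumes "A \<in> carrier_mat k n"
  shows "lawrence_lifting r A \<in> carrier_mat (r * k + n) (r * n)"
  using assms diag_block_mat_replicate_carrier[OF assms, of r]
  unfolding lawrence_lifting_def by auto

lemma diag_block_mat_replicate_mult_vec:
  assumes A: "A \<in> carrier_mat k n" and v: "v \<in> carrier_vec (r * n)"
  shows "diag_block_mat (replicate r A) *\<^sub>v v = 0\<^sub>v (r * k) \<longleftrightarrow>
         (\<forall>i<r. A *\<^sub>v block_row n v i = 0\<^sub>v k)"
  using v
proof (induction r arbitrary: v)
  case 0
  then show ?case by (auto intro!: eq_vecI simp: scalar_prod_def)
next
  case (Suc r)
  let ?D = "diag_block_mat (replicate r A)"
  let ?x = "block_row n v 0" and ?y = "vec (r * n) (\<lambda>j. v $ (n + j))"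
  have D: "?D \<in> carrier_mat (r * k) (r * n)"
    by (rule diag_block_mat_replicate_carrier[OF A])
  have v: "v = ?x @\<^sub>v ?y"
    using Suc.prems by (intro eq_vecI) (auto simp: block_row_def append_vec_def Let_def)
  have x: "?x \<in> carrier_vec n" by (simp add: block_row_def)
  have y: "?y \<in> carrier_vec (r * n)" by simp
  have "diag_block_mat (replicate (Suc r) A) *\<^sub>v v = A *\<^sub>v ?x @\<^sub>v ?D *\<^sub>v ?y"
  proof -
    have "diag_block_mat (replicate (Suc r) A) =
        four_block_mat A (0\<^sub>m k (r * n)) (0\<^sub>m (r * k) n) ?D"
      using A D by (auto simp: Let_def)
    then have "diag_block_mat (replicate (Suc r) A) *\<^sub>v v =
        (A *\<^sub>v ?x + 0\<^sub>m k (r * n) *\<^sub>v ?y) @\<^sub>v (0\<^sub>m (r * k) n *\<^sub>v ?x + ?D *\<^sub>v ?y)"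
      using four_block_mat_mult_vec[OF A zero_carrier_mat zero_carrier_mat D x y] v by simp
    moreover have "A *\<^sub>v ?x + 0\<^sub>m k (r * n) *\<^sub>v ?y = A *\<^sub>v ?x"
      using A by (intro eq_vecI) auto
    moreover have "0\<^sub>m (r * k) n *\<^sub>v ?x + ?D *\<^sub>v ?y = ?D *\<^sub>v ?y"
      using D x by (intro eq_vecI) auto
    ultimately show ?thesis by simp
  qed
  moreover have "(0\<^sub>v (Suc r * k) :: int vec) = 0\<^sub>v k @\<^sub>v 0\<^sub>v (r * k)"
    by (intro eq_vecI) (auto simp: append_vec_def Let_def)
  moreover have "(A *\<^sub>v ?x @\<^sub>v ?D *\<^sub>v ?y = 0\<^sub>v k @\<^sub>v 0\<^sub>v (r * k)) \<longleftrightarrow>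
      (A *\<^sub>v ?x = 0\<^sub>v k \<and> ?D *\<^sub>v ?y = 0\<^sub>v (r * k))"
    using A x by (intro append_vec_eq[of _ k]) auto
  moreover have "block_row n ?y i = block_row n v (Suc i)" if "i < r" for i
  proof -
    have "i * n + j < r * n" if "j < n" for j
    proof -
      have "i * n + j < Suc i * n" using that by simp
      also have "\<dots> \<le> r * n" using \<open>i < r\<close> by (intro mult_right_mono) auto
      finally show ?thesis .
    qed
    then show ?thesis by (intro eq_vecI) (auto simp: block_row_def add.assoc)
  qed
  ultimately show ?case
    using Suc.IH[OF y] by (simp add: All_less_Suc2)
qed

lemma identity_blocks_mult_vec:
  assumes v: "v \<in> carrier_vec (r * n)"
  shows "mat n (r * n) (\<lambda>(i, j). if j mod n = i then 1 else 0) *\<^sub>v v = 0\<^sub>v n \<longleftrightarrow>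
         (\<forall>j<n. (\<Sum>i<r. block_row n v i $ j) = 0)"
proof -
  have "(\<Sum>l<r * n. (if l mod n = j then 1 else 0) * v $ l) = (\<Sum>i<r. block_row n v i $ j)"
    if "j < n" for j
  proof -
    have "(\<Sum>l<r * n. (if l mod n = j then 1 else 0) * v $ l) =
        (\<Sum>i<r. \<Sum>l\<in>{i * n..<i * n + n}. (if l mod n = j then 1 else 0) * v $ l)"
      by (rule sum.nat_group[symmetric])
    also have "\<dots> = (\<Sum>i<r. block_row n v i $ j)"
    proof (rule sum.cong[OF refl])
      fix i
      have "(\<Sum>l\<in>{i * n..<i * n + n}. (if l mod n = j then 1 else 0) * v $ l) =
          (\<Sum>l\<in>{0..<n}. (if (l + i * n) mod n = j then 1 else 0) * v $ (l + i * n))"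
        using sum.shift_bounds_nat_ivl[of "\<lambda>l. (if l mod n = j then 1 else 0) * v $ l" 0 "i * n" n]
        by (simp add: add.commute)
      also have "\<dots> = (\<Sum>l\<in>{0..<n}. if l = j then v $ (l + i * n) else 0)"
        by (rule sum.cong) auto
      also have "\<dots> = block_row n v i $ j"
        using that by (simp add: block_row_def add.commute)
      finally show "(\<Sum>l\<in>{i * n..<i * n + n}. (if l mod n = j then 1 else 0) * v $ l) =
          block_row n v i $ j" .
    qed
    finally show ?thesis .
  qed
  then show ?thesis
    using v by (simp add: vec_eq_iff scalar_prod_def lessThan_atLeast0)
qed

lemma lawrence_lifting_kernel:
  assumes A: "A \<in> carrier_mat k n"
  shows "v \<in> mat_kernel (lawrence_lifting r A) \<longleftrightarrow>
         v \<in> carrier_vec (r * n) \<and>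
         (\<forall>i<r. block_row n v i \<in> mat_kernel A) \<and>
         (\<forall>j<n. (\<Sum>i<r. block_row n v i $ j) = 0)"
proof (cases "v \<in> carrier_vec (r * n)")
  case True
  let ?D = "diag_block_mat (replicate r A)"
  let ?I = "mat n (r * n) (\<lambda>(i, j). if j mod n = i then 1 else 0) :: int mat"
  have D: "?D \<in> carrier_mat (r * k) (r * n)"
    by (rule diag_block_mat_replicate_carrier[OF A])
  have L: "lawrence_lifting r A = ?D @\<^sub>r ?I"
    using A by (simp add: lawrence_lifting_def)
  have "lawrence_lifting r A *\<^sub>v v = ?D *\<^sub>v v @\<^sub>v ?I *\<^sub>v v"
    unfolding L by (rule mat_mult_append[OF D mat_carrier True])
  moreover have "(0\<^sub>v (r * k + n) :: int vec) = 0\<^sub>v (r * k) @\<^sub>v 0\<^sub>v n"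
    by (intro eq_vecI) (auto simp: append_vec_def Let_def)
  moreover have "(?D *\<^sub>v v @\<^sub>v ?I *\<^sub>v v = 0\<^sub>v (r * k) @\<^sub>v 0\<^sub>v n) \<longleftrightarrow>
      (?D *\<^sub>v v = 0\<^sub>v (r * k) \<and> ?I *\<^sub>v v = 0\<^sub>v n)"
    using mult_mat_vec_carrier[OF D True] by (intro append_vec_eq[of _ "r * k"]) auto
  ultimately show ?thesis
    using True A lawrence_lifting_carrier[OF A, of r]
      diag_block_mat_replicate_mult_vec[OF A True] identity_blocks_mult_vec[OF True]
    by (auto simp: mat_kernel_def block_row_def)
next
  case False
  then show ?thesis
    using lawrence_lifting_carrier[OF A, of r] by (auto simp: mat_kernel_def)
qed

lemma lawrence_lifting_nonneg:
  assumes "\<forall>x \<in> elements_mat A. 0 \<le> x"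
  shows "\<forall>x \<in> elements_mat (lawrence_lifting r A). 0 \<le> x"
proof -
  let ?D = "diag_block_mat (replicate r A)"
  have "elements_mat ?D \<subseteq> {0} \<union> \<Union> (set (map elements_mat (replicate r A)))"
    by (rule elements_diag_block_mat)
  then have "\<forall>x \<in> elements_mat ?D. 0 \<le> x"
    using assms by fastforce
  then have "0 \<le> ?D $$ (i, j)" if "i < dim_row ?D" "j < dim_col ?D" for i j
    using that by auto
  then show ?thesis
    by (auto simp: lawrence_lifting_def append_rows_def elements_mat_def dim_diag_block_mat
        sum_list_replicate)
qed

lemma lawrence_lifting_pointed:
  assumes A: "A \<in> carrier_mat k n"
  shows "mat_kernel (lawrence_lifting r A) \<inter> nonneg_vecs (r * n) = {0\<^sub>v (r * n)}"
proof (intro equalityI subsetI)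
  fix v
  assume v: "v \<in> mat_kernel (lawrence_lifting r A) \<inter> nonneg_vecs (r * n)"
  then have dim: "v \<in> carrier_vec (r * n)" and nonneg: "\<And>l. l < r * n \<Longrightarrow> 0 \<le> v $ l"
    by (auto simp: nonneg_vecs_def)
  have "v $ l = 0" if l: "l < r * n" for l
  proof -
    let ?j = "l mod n"
    have n: "0 < n" using l by (cases n) auto
    have bound: "i * n + ?j < r * n" if "i < r" for i
    proof -
      have "i * n + ?j < Suc i * n" using n by simp
      also have "\<dots> \<le> r * n" using that by (intro mult_right_mono) auto
      finally show ?thesis .
    qed
    have "(\<Sum>i<r. v $ (i * n + ?j)) = 0"
      using v n lawrence_lifting_kernel[OF A] by (auto simp: block_row_def)
    then have "\<forall>i<r. v $ (i * n + ?j) = 0"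
      using sum_nonneg_eq_0_iff[of "{..<r}" "\<lambda>i. v $ (i * n + ?j)"] nonneg bound by auto
    moreover have "l div n < r" using l by (simp add: less_mult_imp_div_less)
    ultimately show ?thesis using div_mult_mod_eq[of l n] by metis
  qed
  then show "v \<in> {0\<^sub>v (r * n)}" using dim by auto
next
  fix v :: "int vec"
  assume "v \<in> {0\<^sub>v (r * n)}"
  then show "v \<in> mat_kernel (lawrence_lifting r A) \<inter> nonneg_vecs (r * n)"
    using lawrence_lifting_carrier[OF A, of r] by (auto simp: mat_kernel_def nonneg_vecs_def)
qed

end

theory Submission
  imports Defs
begin

text \<open>
  If a fiber of \<open>M\<close> consists of two points \<open>w\<close> and \<open>u\<close> only, every walk from \<open>w\<close> to \<open>u\<close> inside the
  fiber uses the move \<open>w - u\<close> up to sign. So \<open>w - u\<close> or its negative lies in every Markov basis, in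
  particular in a minimal one (\<open>two_point_fiber_indispensable\<close>), provided that a minimal one exists at
  all; it does because the Graver basis is a finite Markov basis (\<open>markov_basis_graver_basis\<close>). It
  remains to find, for a suitable curve, a two-point fiber of a Lawrence lifting with many rows such
  that the two points differ in every row.

  For \<open>k \<ge> 1\<close> consider four variables of degree one with weights \<open>0, 1, k + 1, k + 2\<close>. Among the
  binomials of this projective monomial curve are
    \<open>x\<^sub>1^(k+1) - x\<^sub>0^k x\<^sub>2\<close>, \<open>x\<^sub>2^(k+1) - x\<^sub>1 x\<^sub>3^k\<close> and \<open>x\<^sub>0 x\<^sub>3 - x\<^sub>1 x\<^sub>2\<close>,
  and for each of them the two monomials shown are the only ones of their degree and weight. The
  exponent vectors \<open>f\<close>, \<open>g\<close>, \<open>h\<close> of the three binomials satisfy \<open>f + g + k h = 0\<close>, and up to multiples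
  this is their only linear relation. Take \<open>k + 2\<close> rows: one for \<open>f\<close>, one for \<open>g\<close> and \<open>k\<close> for \<open>h\<close>.
  Let \<open>w\<close> consist of the first monomials and \<open>u\<close> of the second ones. Their column sums agree by the
  relation. A point of the fiber of \<open>w\<close> chooses one of two monomials in each row, and since no
  proper nonempty part of the relation sums to zero, only \<open>w\<close> and \<open>u\<close> have the right column sums
  (\<open>two_point_fiber\<close>).

  To obtain a monomial curve, degree and weight are merged into the single weights \<open>T\<close>, \<open>T + 1\<close>,
  \<open>T + k + 1\<close>, \<open>T + k + 2\<close> with \<open>T = (k + 2)\<^sup>2\<close>, which is large enough to recover both
  (\<open>degree_and_offset_sum\<close>). Ambient dimensions above four only add columns in which \<open>w\<close> has sum zero,
  so that they vanish throughout the fiber.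
\<close>

section \<open>Finiteness of the Graver basis\<close>

lemma incseq_subsequence_nat:
  fixes f :: "nat \<Rightarrow> nat"
  shows "\<exists>\<phi>. strict_mono \<phi> \<and> incseq (\<lambda>n. f (\<phi> n))"
proof -
  obtain s where s: "strict_mono s" and mono: "monoseq (\<lambda>n. f (s n))"
    using seq_monosub[of f] by auto
  show ?thesis
  proof (cases "incseq (\<lambda>n. f (s n))")
    case True
    then show ?thesis using s by blast
  next
    case False
    then have dec: "decseq (\<lambda>n. f (s n))" using mono by (simp add: monoseq_iff)
    \<comment> \<open>A decreasing sequence of naturals is constant from the point where it attains its
        minimum.\<close>
    obtain N where N: "\<And>n. f (s N) \<le> f (s n)"
      using ex_has_least_nat[of "\<lambda>_. True" 0 "\<lambda>n. f (s n)"] by auto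
    have const: "f (s (N + n)) = f (s N)" for n
      using N[of "N + n"] decseqD[OF dec, of N "N + n"] by simp
    have "strict_mono (\<lambda>n. s (N + n))"
      using s by (simp add: strict_mono_def)
    moreover have "incseq (\<lambda>n. f (s (N + n)))"
      by (simp add: const)
    ultimately show ?thesis by blast
  qed
qed

text \<open>
  Dickson's lemma in sequence form: passing to a monotone subsequence for one coordinate does not
  destroy monotonicity in the coordinates treated before.
\<close>

lemma dickson_subsequence:
  fixes x :: "nat \<Rightarrow> 'a" and F :: "('a \<Rightarrow> nat) set"
  assumes "finite F"
  shows "\<exists>\<phi>. strict_mono \<phi> \<and> (\<forall>f\<in>F. incseq (\<lambda>n. f (x (\<phi> n))))"
  using assms
proof (induction F)
  case empty
  then show ?case using strict_mono_id by blast
next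
  case (insert g F)
  then obtain \<phi> where \<phi>: "strict_mono \<phi>" "\<forall>f\<in>F. incseq (\<lambda>n. f (x (\<phi> n)))" by blast
  obtain \<psi> where \<psi>: "strict_mono \<psi>" "incseq (\<lambda>n. g (x (\<phi> (\<psi> n))))"
    using incseq_subsequence_nat[of "\<lambda>n. g (x (\<phi> n))"] by auto
  have "strict_mono (\<lambda>n. \<phi> (\<psi> n))"
    using \<phi>(1) \<psi>(1) by (simp add: strict_mono_def)
  moreover have "incseq (\<lambda>n. f (x (\<phi> (\<psi> n))))" if "f \<in> F" for f
    using \<phi>(2) that \<psi>(1) by (auto simp: incseq_def strict_mono_less_eq)
  ultimately show ?case using \<psi>(2) by blast
qed

definition conformal :: "nat \<Rightarrow> int vec \<Rightarrow> int vec \<Rightarrow> bool" where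
  "conformal N g v \<longleftrightarrow>
     (\<forall>j<N. (0 \<le> g $ j \<and> g $ j \<le> v $ j) \<or> (v $ j \<le> g $ j \<and> g $ j \<le> 0))"

definition graver_basis :: "int mat \<Rightarrow> int vec set" where
  "graver_basis M =
     {g \<in> mat_kernel M - {0\<^sub>v (dim_col M)}.
        \<forall>h \<in> mat_kernel M - {0\<^sub>v (dim_col M)}. conformal (dim_col M) h g \<longrightarrow> h = g}"

definition l1_norm :: "nat \<Rightarrow> int vec \<Rightarrow> nat" where
  "l1_norm N v = (\<Sum>j<N. nat \<bar>v $ j\<bar>)"

lemma conformal_refl: "conformal N v v"
  by (auto simp: conformal_def)

lemma conformal_trans:
  assumes "conformal N g h" and "conformal N h v"
  shows "conformal N g v"
  unfolding conformal_def
proof (intro allI impI)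
  fix j assume "j < N"
  then show "(0 \<le> g $ j \<and> g $ j \<le> v $ j) \<or> (v $ j \<le> g $ j \<and> g $ j \<le> 0)"
    using assms unfolding conformal_def by (smt (verit))
qed

lemma mat_kernel_minus_closed:
  fixes M :: "int mat"
  assumes "u \<in> mat_kernel M" and "v \<in> mat_kernel M"
  shows "u - v \<in> mat_kernel M"
proof -
  have M: "M \<in> carrier_mat (dim_row M) (dim_col M)" by auto
  have u: "u \<in> carrier_vec (dim_col M)" "M *\<^sub>v u = 0\<^sub>v (dim_row M)"
    and v: "v \<in> carrier_vec (dim_col M)" "M *\<^sub>v v = 0\<^sub>v (dim_row M)"
    using assms by (auto simp: mat_kernel_def)
  have "M *\<^sub>v (u - v) = 0\<^sub>v (dim_row M)"
    using mult_minus_distrib_mat_vec[OF M u(1) v(1)] u(2) v(2) by simp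
  then show ?thesis using u(1) v(1) by (auto simp: mat_kernel_def)
qed

lemma mat_kernel_carrier: "v \<in> mat_kernel M \<Longrightarrow> v \<in> carrier_vec (dim_col M)"
  by (simp add: mat_kernel_def)

text \<open>
  Splitting every coordinate into its positive and its negative part turns the conformal order into
  the product order on \<open>\<nat>\<^sup>2\<^sup>N\<close>, where Dickson's lemma forbids infinite antichains.
\<close>

lemma finite_graver_basis: "finite (graver_basis M)"
proof (rule ccontr)
  assume "infinite (graver_basis M)"
  then obtain x :: "nat \<Rightarrow> int vec" where x: "inj x" "range x \<subseteq> graver_basis M"
    using infinite_countable_subset by blast
  let ?N = "dim_col M"
  define F where "F = (\<lambda>j (v :: int vec). nat (v $ j)) ` {..<?N} \<union>
    (\<lambda>j (v :: int vec). nat (- (v $ j))) ` {..<?N}"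
  have "finite F" by (simp add: F_def)
  then obtain \<phi> where \<phi>: "strict_mono \<phi>" "\<forall>f\<in>F. incseq (\<lambda>n. f (x (\<phi> n)))"
    using dickson_subsequence[of F x] by blast
  have "conformal ?N (x (\<phi> 0)) (x (\<phi> 1))"
    unfolding conformal_def
  proof (intro allI impI)
    fix j assume j: "j < ?N"
    have "(\<lambda>v. nat (v $ j)) \<in> F" "(\<lambda>v. nat (- (v $ j))) \<in> F"
      using j by (auto simp: F_def)
    then have "nat (x (\<phi> 0) $ j) \<le> nat (x (\<phi> 1) $ j)"
      and "nat (- (x (\<phi> 0) $ j)) \<le> nat (- (x (\<phi> 1) $ j))"
      using \<phi>(2) by (force simp: incseq_def)+
    then show "(0 \<le> x (\<phi> 0) $ j \<and> x (\<phi> 0) $ j \<le> x (\<phi> 1) $ j) \<or>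
        (x (\<phi> 1) $ j \<le> x (\<phi> 0) $ j \<and> x (\<phi> 0) $ j \<le> 0)"
      by linarith
  qed
  moreover have "x (\<phi> 0) \<in> graver_basis M" "x (\<phi> 1) \<in> graver_basis M"
    using x(2) by auto
  ultimately have "x (\<phi> 0) = x (\<phi> 1)"
    by (auto simp: graver_basis_def)
  then have "\<phi> 0 = \<phi> 1" using x(1) by (auto dest: injD)
  then show False using \<phi>(1) strict_mono_less[of \<phi> 0 1] by simp
qed

lemma l1_norm_conformal_less:
  assumes "conformal N g v" and "g \<in> carrier_vec N" and "v \<in> carrier_vec N" and "g \<noteq> v"
  shows "l1_norm N g < l1_norm N v"
proof -
  obtain j where j: "j < N" "g $ j \<noteq> v $ j"
    using assms by (metis carrier_vecD eq_vecI)
  show ?thesis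
    unfolding l1_norm_def
  proof (rule sum_strict_mono_ex1)
    show "\<forall>i\<in>{..<N}. nat \<bar>g $ i\<bar> \<le> nat \<bar>v $ i\<bar>"
      using assms(1) by (fastforce simp: conformal_def)
    show "\<exists>i\<in>{..<N}. nat \<bar>g $ i\<bar> < nat \<bar>v $ i\<bar>"
      using assms(1) j by (intro bexI[of _ j]) (auto simp: conformal_def)
  qed simp
qed

lemma graver_element_below:
  assumes "v \<in> mat_kernel M" and "v \<noteq> 0\<^sub>v (dim_col M)"
  shows "\<exists>g \<in> graver_basis M. conformal (dim_col M) g v"
proof -
  let ?N = "dim_col M"
  let ?P = "\<lambda>h. h \<in> mat_kernel M - {0\<^sub>v ?N} \<and> conformal ?N h v"
  have "?P v" using assms by (simp add: conformal_refl)
  from ex_has_least_nat[of ?P, OF this, of "l1_norm ?N"]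
  obtain g where g: "?P g" and least: "\<And>h. ?P h \<Longrightarrow> l1_norm ?N g \<le> l1_norm ?N h"
    by blast
  have "h = g" if h: "h \<in> mat_kernel M - {0\<^sub>v ?N}" "conformal ?N h g" for h
  proof (rule ccontr)
    assume "h \<noteq> g"
    then have "l1_norm ?N h < l1_norm ?N g"
      using l1_norm_conformal_less[OF h(2)] h(1) g by (auto dest: mat_kernel_carrier)
    moreover have "?P h" using h g conformal_trans by blast
    ultimately show False using least[of h] by simp
  qed
  then have "g \<in> graver_basis M" using g by (simp add: graver_basis_def)
  then show ?thesis using g by blast
qed

section \<open>Minimal Markov bases and indispensable moves\<close>

lemma vec_sum_Nil [simp]: "vec_sum N [] = 0\<^sub>v N"
  by (simp add: vec_sum_def)

lemma vec_sum_Cons [simp]: "vec_sum N (v # vs) = v + vec_sum N vs"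
  by (simp add: vec_sum_def)

lemma vec_sum_carrier:
  assumes "\<forall>v \<in> set vs. v \<in> carrier_vec N"
  shows "vec_sum N vs \<in> carrier_vec N"
  using assms by (induction vs) auto

text \<open>
  Subtracting from \<open>w\<close> a vector conformal to \<open>w - u\<close> moves every coordinate of \<open>w\<close> towards that of
  \<open>u\<close> without overshooting, so the walk along Graver elements never leaves the orthant.
\<close>

lemma graver_walk:
  assumes "w \<in> nonneg_vecs (dim_col M)" and "u \<in> nonneg_vecs (dim_col M)"
    and "w - u \<in> mat_kernel M"
  shows "\<exists>vs. set vs \<subseteq> graver_basis M \<and> w - u = vec_sum (dim_col M) vs \<and>
    (\<forall>p \<in> {1..length vs}. w - vec_sum (dim_col M) (take p vs) \<in> nonneg_vecs (dim_col M))"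
  using assms
proof (induction "l1_norm (dim_col M) (w - u)" arbitrary: w rule: less_induct)
  case less
  let ?N = "dim_col M"
  have wu: "w \<in> carrier_vec ?N" "u \<in> carrier_vec ?N"
    using less.prems by (auto simp: nonneg_vecs_def)
  show ?case
  proof (cases "w - u = 0\<^sub>v ?N")
    case True
    then show ?thesis by (intro exI[of _ "[]"]) auto
  next
    case False
    then obtain g where g: "g \<in> graver_basis M" "conformal ?N g (w - u)"
      using graver_element_below less.prems(3) by blast
    have gK: "g \<in> mat_kernel M" and g0: "g \<noteq> 0\<^sub>v ?N"
      using g(1) by (auto simp: graver_basis_def)
    have gc: "g \<in> carrier_vec ?N" using gK by (rule mat_kernel_carrier)
    have step: "w - g - u = w - u - g" using wu gc by (intro eq_vecI) auto
    have nonneg: "w - g \<in> nonneg_vecs ?N"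
      unfolding nonneg_vecs_def
    proof (intro CollectI conjI allI impI)
      show "w - g \<in> carrier_vec ?N" using wu gc by auto
      fix j assume j: "j < ?N"
      then have "0 \<le> w $ j" "0 \<le> u $ j" using less.prems by (auto simp: nonneg_vecs_def)
      then show "0 \<le> (w - g) $ j"
        using g(2) j wu gc by (fastforce simp: conformal_def)
    qed
    have kernel: "w - g - u \<in> mat_kernel M"
      unfolding step by (rule mat_kernel_minus_closed[OF less.prems(3) gK])
    have "conformal ?N (w - g - u) (w - u)"
      unfolding conformal_def
    proof (intro allI impI)
      fix j assume j: "j < ?N"
      then have "(0 \<le> g $ j \<and> g $ j \<le> w $ j - u $ j) \<or> (w $ j - u $ j \<le> g $ j \<and> g $ j \<le> 0)"
        using g(2) wu by (simp add: conformal_def)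
      then show "(0 \<le> (w - g - u) $ j \<and> (w - g - u) $ j \<le> (w - u) $ j) \<or>
          ((w - u) $ j \<le> (w - g - u) $ j \<and> (w - g - u) $ j \<le> 0)"
        using j wu gc by auto
    qed
    moreover have "w - g - u \<noteq> w - u"
    proof
      assume eq: "w - g - u = w - u"
      have "g $ j = 0" if "j < ?N" for j
        using arg_cong[OF eq, of "\<lambda>v. v $ j"] that wu gc by simp
      then have "g = 0\<^sub>v ?N" using gc by (intro eq_vecI) auto
      then show False using g0 by simp
    qed
    ultimately have "l1_norm ?N (w - g - u) < l1_norm ?N (w - u)"
      using wu gc by (intro l1_norm_conformal_less) auto
    from less.hyps[OF this nonneg less.prems(2) kernel]
    obtain vs where vs: "set vs \<subseteq> graver_basis M" "w - g - u = vec_sum ?N vs"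
      "\<forall>p \<in> {1..length vs}. w - g - vec_sum ?N (take p vs) \<in> nonneg_vecs ?N"
      by blast
    have vsc: "\<forall>v \<in> set vs. v \<in> carrier_vec ?N"
      using vs(1) by (auto simp: graver_basis_def dest: mat_kernel_carrier)
    have "w - u = vec_sum ?N (g # vs)"
      using wu gc by (simp add: vs(2)[symmetric]) (intro eq_vecI, auto)
    moreover have "w - vec_sum ?N (take p (g # vs)) \<in> nonneg_vecs ?N"
      if p: "p \<in> {1..length (g # vs)}" for p
    proof -
      obtain q where q: "p = Suc q" using p by (cases p) auto
      have "vec_sum ?N (take q vs) \<in> carrier_vec ?N"
        using vsc by (intro vec_sum_carrier) (auto dest: in_set_takeD)
      then have eq: "w - vec_sum ?N (take p (g # vs)) = w - g - vec_sum ?N (take q vs)"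
        using wu gc by (simp add: q) (intro eq_vecI, auto)
      show ?thesis
      proof (cases "q = 0")
        case True
        have "w - g - 0\<^sub>v ?N = w - g" using wu gc by (intro eq_vecI) auto
        then show ?thesis unfolding eq using True nonneg by simp
      next
        case False
        then show ?thesis unfolding eq using vs(3) p q by auto
      qed
    qed
    ultimately show ?thesis
      using vs(1) g(1) by (intro exI[of _ "g # vs"]) auto
  qed
qed

lemma markov_basis_graver_basis: "markov_basis M (graver_basis M)"
  unfolding markov_basis_def
proof (intro conjI ballI impI)
  show "finite (graver_basis M)" by (rule finite_graver_basis)
  show "graver_basis M \<subseteq> mat_kernel M" by (auto simp: graver_basis_def)
  fix w u
  assume "w \<in> nonneg_vecs (dim_col M)" "u \<in> nonneg_vecs (dim_col M)" "w - u \<in> mat_kernel M"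
  from graver_walk[OF this]
  show "\<exists>vs. (\<forall>v \<in> set vs. v \<in> graver_basis M \<or> - v \<in> graver_basis M) \<and>
      w - u = vec_sum (dim_col M) vs \<and>
      (\<forall>p \<in> {1..length vs}. w - vec_sum (dim_col M) (take p vs) \<in> nonneg_vecs (dim_col M))"
    by blast
qed

lemma minimal_markov_basis_exists: "\<exists>B. minimal_markov_basis M B"
proof -
  obtain B where B: "markov_basis M B" and least: "\<And>B'. markov_basis M B' \<Longrightarrow> card B \<le> card B'"
    using ex_has_least_nat[of "markov_basis M", OF markov_basis_graver_basis, of card] by blast
  have "\<not> markov_basis M B'" if "B' \<subset> B" for B'
  proof
    assume "markov_basis M B'"
    moreover have "card B' < card B"
      using that B by (intro psubset_card_mono) (auto simp: markov_basis_def)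
    ultimately show False using least[of B'] by simp
  qed
  then show ?thesis using B by (auto simp: minimal_markov_basis_def)
qed

text \<open>
  On a fiber with only two points a walk from one to the other can only stand still, by zero moves,
  until it jumps.
\<close>

lemma two_point_fiber_jump:
  assumes w: "w \<in> nonneg_vecs N" and u: "u \<in> nonneg_vecs N" and ne: "w \<noteq> u"
    and fiber: "\<And>y. y \<in> nonneg_vecs N \<Longrightarrow> w - y \<in> K \<Longrightarrow> y = w \<or> y = u"
    and "set vs \<subseteq> K" and "K \<subseteq> carrier_vec N"
    and "w - u = vec_sum N vs"
    and "\<forall>p \<in> {1..length vs}. w - vec_sum N (take p vs) \<in> nonneg_vecs N"
  shows "w - u \<in> set vs"
  using assms(5-)
proof (induction vs)
  case Nil
  have "w = u"
  proof (rule eq_vecI)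
    show "dim_vec w = dim_vec u" using w u by (auto simp: nonneg_vecs_def)
    fix j assume "j < dim_vec u"
    then show "w $ j = u $ j"
      using arg_cong[OF Nil(3), of "\<lambda>v. v $ j"] u by (auto simp: nonneg_vecs_def)
  qed
  then show ?case using ne by simp
next
  case (Cons v vs)
  have c: "w \<in> carrier_vec N" "u \<in> carrier_vec N" "v \<in> carrier_vec N"
    using w u Cons.prems by (auto simp: nonneg_vecs_def)
  have "w - (v + 0\<^sub>v N) \<in> nonneg_vecs N"
    using Cons.prems(4)[rule_format, of 1] by simp
  then have "w - v \<in> nonneg_vecs N" using c by simp
  moreover have undo: "w - (w - v) = v" using c by (intro eq_vecI) auto
  ultimately consider "w - v = w" | "w - v = u"
    using fiber[of "w - v"] Cons.prems(1) by auto
  then show ?case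
  proof cases
    case 1
    have v0: "v = 0\<^sub>v N" using undo c by (simp add: 1)
    have vc: "vec_sum N (take p vs) \<in> carrier_vec N" for p
      using Cons.prems by (intro vec_sum_carrier) (auto dest: in_set_takeD)
    have "w - u \<in> set vs"
    proof (rule Cons.IH)
      show "w - u = vec_sum N vs"
        using Cons.prems(3) v0 vc[of "length vs"] by simp
      show "\<forall>p\<in>{1..length vs}. w - vec_sum N (take p vs) \<in> nonneg_vecs N"
      proof
        fix p assume "p \<in> {1..length vs}"
        then show "w - vec_sum N (take p vs) \<in> nonneg_vecs N"
          using Cons.prems(4)[rule_format, of "Suc p"] v0 vc[of p] by simp
      qed
    qed (use Cons.prems in auto)
    then show ?thesis by simp
  next
    case 2
    then show ?thesis using undo by simp
  qed
qed

lemma two_point_fiber_indispensable: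
  assumes "w \<in> nonneg_vecs (dim_col M)" and "u \<in> nonneg_vecs (dim_col M)" and "w \<noteq> u"
    and "w - u \<in> mat_kernel M"
    and "\<And>y. y \<in> nonneg_vecs (dim_col M) \<Longrightarrow> w - y \<in> mat_kernel M \<Longrightarrow> y = w \<or> y = u"
  shows "w - u \<in> universal_markov_basis M \<or> - (w - u) \<in> universal_markov_basis M"
proof -
  obtain B where B: "minimal_markov_basis M B"
    using minimal_markov_basis_exists by blast
  let ?N = "dim_col M"
  have K: "B \<subseteq> mat_kernel M" and mb: "markov_basis M B"
    using B by (auto simp: minimal_markov_basis_def markov_basis_def)
  obtain vs where vs: "\<forall>v \<in> set vs. v \<in> B \<or> - v \<in> B" "w - u = vec_sum ?N vs"
    "\<forall>p \<in> {1..length vs}. w - vec_sum ?N (take p vs) \<in> nonneg_vecs ?N"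
    using mb assms unfolding markov_basis_def by blast
  have "set vs \<subseteq> mat_kernel M"
  proof
    fix v assume "v \<in> set vs"
    then have "v \<in> mat_kernel M \<or> - v \<in> mat_kernel M" using vs(1) K by blast
    moreover have "v \<in> mat_kernel M" if v: "- v \<in> mat_kernel M"
    proof -
      have vc: "v \<in> carrier_vec ?N" using mat_kernel_carrier[OF v] by simp
      have "- v - - v \<in> mat_kernel M" "- v - - v - - v = v"
        using mat_kernel_minus_closed[OF v v] vc by (auto intro!: eq_vecI)
      then show ?thesis using mat_kernel_minus_closed[of "- v - - v" M "- v"] v by simp
    qed
    ultimately show "v \<in> mat_kernel M" by blast
  qed
  then have "w - u \<in> set vs"
    using assms vs by (intro two_point_fiber_jump[where K = "mat_kernel M" and N = ?N])
      (auto dest: mat_kernel_carrier)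
  then have "w - u \<in> B \<or> - (w - u) \<in> B" using vs(1) by blast
  then show ?thesis using B by (auto simp: universal_markov_basis_def)
qed

section \<open>The curve and its row fibers\<close>

text \<open>
  The offsets \<open>0, 1, k + 1, k + 2\<close> of the first four variables carry the argument. The later ones just
  continue upwards, which keeps the integers distinct.
\<close>

definition curve_offset :: "nat \<Rightarrow> nat \<Rightarrow> int" where
  "curve_offset k j = (if j < 2 then int j else int k - 1 + int j)"

definition wide_curve :: "nat \<Rightarrow> nat \<Rightarrow> int list" where
  "wide_curve k m = map (\<lambda>j. (int k + 2)\<^sup>2 + curve_offset k j) [0..<m]"

lemma monomial_curve_wide_curve:
  assumes "1 \<le> k"
  shows "monomial_curve m (wide_curve k m)"
proof -
  have "inj_on (\<lambda>j. (int k + 2)\<^sup>2 + curve_offset k j) (set [0..<m])"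
    using assms by (intro inj_onI) (auto simp: curve_offset_def split: if_splits)
  moreover have "0 < (int k + 2)\<^sup>2 + curve_offset k j" for j
    using assms by (auto simp: curve_offset_def intro!: add_pos_nonneg)
  ultimately show ?thesis
    by (auto simp: monomial_curve_def wide_curve_def distinct_map)
qed

text \<open>
  A monomial \<open>y\<close> of degree at most \<open>D - 1\<close> has offset sum at most \<open>c (D - 1) < T\<close>, too little to make up
  for the missing \<open>T\<close>; a monomial of degree at least \<open>D + 1\<close> already has weight above \<open>T D + V\<close>, because
  \<open>V < T\<close>.
\<close>

lemma degree_and_offset_sum:
  fixes T c y0 y1 y2 y3 D V :: int
  assumes nonneg: "0 \<le> y0" "0 \<le> y1" "0 \<le> y2" "0 \<le> y3" "0 \<le> V" and c: "1 \<le> c"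
    and eq: "T * y0 + (T + 1) * y1 + (T + c - 1) * y2 + (T + c) * y3 = T * D + V"
    and "V < T" and "c * (D - 1) < T"
  shows "y0 + y1 + y2 + y3 = D" and "y1 + (c - 1) * y2 + c * y3 = V"
proof -
  define S where "S = y0 + y1 + y2 + y3"
  define X where "X = y1 + (c - 1) * y2 + c * y3"
  have eq': "T * S + X = T * D + V"
    using eq by (simp add: S_def X_def algebra_simps)
  have X0: "0 \<le> X" using nonneg c by (simp add: X_def)
  have T0: "0 \<le> T" using assms by linarith
  have "0 \<le> c * y0 + (c - 1) * y1 + y2" using nonneg c by simp
  then have XS: "X \<le> c * S" by (simp add: X_def S_def algebra_simps)
  have "S = D"
  proof (rule antisym)
    show "S \<le> D"
    proof (rule ccontr)
      assume "\<not> S \<le> D"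
      then have "T * (D + 1) \<le> T * S" using T0 by (intro mult_left_mono) auto
      then show False using eq' X0 assms by (simp add: algebra_simps)
    qed
    show "D \<le> S"
    proof (rule ccontr)
      assume "\<not> D \<le> S"
      then have "T * S \<le> T * (D - 1)" "c * S \<le> c * (D - 1)"
        using T0 c by (auto intro!: mult_left_mono)
      then have "X < T" "T * S \<le> T * D - T" using XS assms by (auto simp: algebra_simps)
      then show False using eq' nonneg by linarith
    qed
  qed
  then show "y0 + y1 + y2 + y3 = D" and "y1 + (c - 1) * y2 + c * y3 = V"
    using eq' by (auto simp: S_def X_def)
qed

text \<open>
  The monomials of degree and weight \<open>c - 1\<close>: the variable of weight \<open>c\<close> cannot occur, and the one of
  weight \<open>c - 1\<close>, if it occurs, exhausts the weight, so that only weight \<open>0\<close> is left for the rest.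
\<close>

lemma pure_power_row_fiber:
  fixes c y0 y1 y2 y3 :: int
  assumes nonneg: "0 \<le> y0" "0 \<le> y1" "0 \<le> y2" "0 \<le> y3" and c: "3 \<le> c"
    and S: "y0 + y1 + y2 + y3 = c - 1"
    and V: "y1 + (c - 1) * y2 + c * y3 = c - 1"
  shows "(y0 = 0 \<and> y1 = c - 1 \<and> y2 = 0 \<and> y3 = 0) \<or>
         (y0 = c - 2 \<and> y1 = 0 \<and> y2 = 1 \<and> y3 = 0)"
proof -
  have p2: "0 \<le> (c - 1) * y2" and p3: "0 \<le> c * y3" using nonneg c by auto
  have y3: "y3 = 0"
  proof (rule ccontr)
    assume "y3 \<noteq> 0"
    then have "c * 1 \<le> c * y3" using nonneg c by (intro mult_left_mono) auto
    then show False using V p2 nonneg c by linarith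
  qed
  have "y2 < 2"
  proof (rule ccontr)
    assume "\<not> y2 < 2"
    then have "(c - 1) * 2 \<le> (c - 1) * y2" using c by (intro mult_left_mono) auto
    then have "2 * c - 2 \<le> (c - 1) * y2" by simp
    then show False using V p3 nonneg c by linarith
  qed
  then consider "y2 = 0" | "y2 = 1" using nonneg by linarith
  then show ?thesis
    by cases (use S V y3 in auto)
qed

lemma quadric_row_fiber:
  fixes c y0 y1 y2 y3 :: int
  assumes nonneg: "0 \<le> y0" "0 \<le> y1" "0 \<le> y2" "0 \<le> y3" and c: "3 \<le> c"
    and S: "y0 + y1 + y2 + y3 = 2"
    and V: "y1 + (c - 1) * y2 + c * y3 = c"
  shows "(y0 = 1 \<and> y1 = 0 \<and> y2 = 0 \<and> y3 = 1) \<or>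
         (y0 = 0 \<and> y1 = 1 \<and> y2 = 1 \<and> y3 = 0)"
proof -
  have pos: "0 \<le> (c - 1) * y2" "0 \<le> c * y3" using nonneg c by auto
  have "y2 \<noteq> 2"
  proof
    assume "y2 = 2"
    then have "(c - 1) * y2 = 2 * c - 2" by simp
    then show False using V pos nonneg c by linarith
  qed
  moreover have "y3 \<noteq> 2"
  proof
    assume "y3 = 2"
    then have "c * y3 = 2 * c" by simp
    then show False using V pos nonneg c by linarith
  qed
  moreover have "y2 = 0 \<or> y2 = 1 \<or> y2 = 2" "y3 = 0 \<or> y3 = 1 \<or> y3 = 2"
    using nonneg S by linarith+
  ultimately show ?thesis
    by (elim disjE) (use S V c nonneg in auto)
qed

section \<open>A fiber with exactly two points\<close>

text \<open>
  As monomials, the rows of \<open>start_point\<close> are \<open>x\<^sub>1^(k+1)\<close>, \<open>x\<^sub>2^(k+1)\<close> and \<open>k\<close> times \<open>x\<^sub>0 x\<^sub>3\<close>; those of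
  \<open>end_point\<close> are \<open>x\<^sub>0^k x\<^sub>2\<close>, \<open>x\<^sub>1 x\<^sub>3^k\<close> and \<open>k\<close> times \<open>x\<^sub>1 x\<^sub>2\<close>.
\<close>

definition start_point :: "nat \<Rightarrow> nat \<Rightarrow> nat \<Rightarrow> int" where
  "start_point k i j =
     (if i = 0 then if j = 1 then int k + 1 else 0
      else if i = 1 then if j = 2 then int k + 1 else 0
      else if j = 0 \<or> j = 3 then 1 else 0)"

definition end_point :: "nat \<Rightarrow> nat \<Rightarrow> nat \<Rightarrow> int" where
  "end_point k i j =
     (if i = 0 then if j = 0 then int k else if j = 2 then 1 else 0
      else if i = 1 then if j = 3 then int k else if j = 1 then 1 else 0
      else if j = 1 \<or> j = 2 then 1 else 0)"

lemma sum_first_four: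
  fixes f :: "nat \<Rightarrow> int"
  assumes "4 \<le> m" and "\<And>j. 4 \<le> j \<Longrightarrow> j < m \<Longrightarrow> f j = 0"
  shows "(\<Sum>j<m. f j) = f 0 + f 1 + f 2 + f 3"
proof -
  have "(\<Sum>j<m. f j) = (\<Sum>j<4. f j)"
    using assms by (intro sum.mono_neutral_right) auto
  then show ?thesis by (simp add: numeral_eq_Suc)
qed

lemma sum_first_two_rows:
  fixes f :: "nat \<Rightarrow> int"
  shows "(\<Sum>i<k + 2. f i) = f 0 + f 1 + (\<Sum>i<k. f (i + 2))"
  by (induction k) (auto simp: numeral_2_eq_2)

lemma row_degree:
  fixes y :: "nat \<Rightarrow> int"
  assumes "4 \<le> m" and "\<And>j. 4 \<le> j \<Longrightarrow> j < m \<Longrightarrow> y j = 0" and c: "c = int k + 2"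
  shows "(\<Sum>j<m. (T + curve_offset k j) * y j) =
    T * y 0 + (T + 1) * y 1 + (T + c - 1) * y 2 + (T + c) * y 3"
proof -
  have "(\<Sum>j<m. (T + curve_offset k j) * y j) = (T + curve_offset k 0) * y 0 +
      (T + curve_offset k 1) * y 1 + (T + curve_offset k 2) * y 2 + (T + curve_offset k 3) * y 3"
    using assms by (intro sum_first_four) auto
  then show ?thesis by (simp add: curve_offset_def c algebra_simps)
qed

lemma row_degree_start_point:
  assumes "4 \<le> m" and c: "c = int k + 2"
  shows "(\<Sum>j<m. (T + curve_offset k j) * start_point k i j) =
    (if i = 0 then T * (c - 1) + (c - 1)
     else if i = 1 then T * (c - 1) + (c - 1) * (c - 1)
     else T * 2 + c)"
proof -
  consider "i = 0" | "i = 1" | "2 \<le> i" by linarith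
  then show ?thesis
    by cases (subst row_degree[OF assms(1) _ c], simp add: start_point_def,
        simp add: start_point_def c algebra_simps)+
qed

lemma row_degree_end_point:
  assumes "4 \<le> m"
  shows "(\<Sum>j<m. (T + curve_offset k j) * end_point k i j) =
    (\<Sum>j<m. (T + curve_offset k j) * start_point k i j)"
proof -
  consider "i = 0" | "i = 1" | "2 \<le> i" by linarith
  then show ?thesis
    unfolding row_degree_start_point[OF assms refl]
    by cases (subst row_degree[OF assms _ refl], simp add: end_point_def,
        simp add: end_point_def algebra_simps)+
qed

lemma column_sum_end_point: "(\<Sum>i<k + 2. end_point k i j) = (\<Sum>i<k + 2. start_point k i j)"
  unfolding sum_first_two_rows by (simp add: start_point_def end_point_def)

lemma row_fiber:
  fixes y :: "nat \<Rightarrow> int"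
  assumes m: "4 \<le> m" and k: "1 \<le> k" and nonneg: "\<And>j. j < m \<Longrightarrow> 0 \<le> y j"
    and tail: "\<And>j. 4 \<le> j \<Longrightarrow> j < m \<Longrightarrow> y j = 0"
    and deg: "(\<Sum>j<m. ((int k + 2)\<^sup>2 + curve_offset k j) * y j) =
      (\<Sum>j<m. ((int k + 2)\<^sup>2 + curve_offset k j) * start_point k i j)"
  shows "(\<forall>j<m. y j = start_point k i j) \<or> (\<forall>j<m. y j = end_point k i j)"
proof -
  define c where "c = int k + 2"
  have c: "3 \<le> c" and kc: "int k = c - 2" using k by (auto simp: c_def)
  have n4: "0 \<le> y 0" "0 \<le> y 1" "0 \<le> y 2" "0 \<le> y 3" using nonneg m by auto
  have "c\<^sup>2 * y 0 + (c\<^sup>2 + 1) * y 1 + (c\<^sup>2 + c - 1) * y 2 + (c\<^sup>2 + c) * y 3 =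
      (\<Sum>j<m. (c\<^sup>2 + curve_offset k j) * y j)"
    by (rule row_degree[where y = y, OF m tail c_def, symmetric])
  also have "\<dots> = (\<Sum>j<m. (c\<^sup>2 + curve_offset k j) * start_point k i j)"
    unfolding c_def by (rule deg)
  also have "\<dots> = (if i = 0 then c\<^sup>2 * (c - 1) + (c - 1)
     else if i = 1 then c\<^sup>2 * (c - 1) + (c - 1) * (c - 1) else c\<^sup>2 * 2 + c)"
    by (rule row_degree_start_point[OF m c_def])
  finally have eq: "c\<^sup>2 * y 0 + (c\<^sup>2 + 1) * y 1 + (c\<^sup>2 + c - 1) * y 2 + (c\<^sup>2 + c) * y 3 =
    (if i = 0 then c\<^sup>2 * (c - 1) + (c - 1)
     else if i = 1 then c\<^sup>2 * (c - 1) + (c - 1) * (c - 1) else c\<^sup>2 * 2 + c)" .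
  have c2: "c * 3 \<le> c\<^sup>2" using c by (simp add: power2_eq_square)
  have sq: "(c - 1) * (c - 1) = c\<^sup>2 - 2 * c + 1" by (simp add: power2_eq_square algebra_simps)
  have D: "c * (c - 1 - 1) < c\<^sup>2" using c by (simp add: power2_eq_square algebra_simps)
  have lift: "\<forall>j<m. y j = f j"
    if "y 0 = f 0" "y 1 = f 1" "y 2 = f 2" "y 3 = f 3" "\<And>j. 4 \<le> j \<Longrightarrow> f j = 0"
    for f :: "nat \<Rightarrow> int"
  proof (intro allI impI)
    fix j assume "j < m"
    moreover have "j = 0 \<or> j = 1 \<or> j = 2 \<or> j = 3 \<or> 4 \<le> j" by linarith
    ultimately show "y j = f j" using that tail by auto
  qed
  have finish: ?thesis
    if "(y 0 = start_point k i 0 \<and> y 1 = start_point k i 1 \<and>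
         y 2 = start_point k i 2 \<and> y 3 = start_point k i 3) \<or>
        (y 0 = end_point k i 0 \<and> y 1 = end_point k i 1 \<and>
         y 2 = end_point k i 2 \<and> y 3 = end_point k i 3)"
    using that
  proof
    assume "y 0 = start_point k i 0 \<and> y 1 = start_point k i 1 \<and>
      y 2 = start_point k i 2 \<and> y 3 = start_point k i 3"
    then have "\<forall>j<m. y j = start_point k i j"
      by (intro lift) (simp_all add: start_point_def)
    then show ?thesis ..
  next
    assume "y 0 = end_point k i 0 \<and> y 1 = end_point k i 1 \<and>
      y 2 = end_point k i 2 \<and> y 3 = end_point k i 3"
    then have "\<forall>j<m. y j = end_point k i j"
      by (intro lift) (simp_all add: end_point_def)
    then show ?thesis ..
  qed
  consider "i = 0" | "i = 1" | "2 \<le> i" by linarith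
  then show ?thesis
  proof cases
    case 1
    have e: "c\<^sup>2 * y 0 + (c\<^sup>2 + 1) * y 1 + (c\<^sup>2 + c - 1) * y 2 + (c\<^sup>2 + c) * y 3 =
        c\<^sup>2 * (c - 1) + (c - 1)"
      unfolding eq using 1 by simp
    have "y 0 + y 1 + y 2 + y 3 = c - 1" "y 1 + (c - 1) * y 2 + c * y 3 = c - 1"
      by (rule degree_and_offset_sum[OF n4 _ _ e _ D]; use c c2 in linarith)+
    from pure_power_row_fiber[OF n4 c this] show ?thesis
      using 1 kc by (intro finish) (auto simp: start_point_def end_point_def)
  next
    case 2
    have e: "c\<^sup>2 * y 0 + (c\<^sup>2 + 1) * y 1 + (c\<^sup>2 + c - 1) * y 2 + (c\<^sup>2 + c) * y 3 =
        c\<^sup>2 * (c - 1) + (c - 1) * (c - 1)"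
      unfolding eq using 2 by simp
    have V0: "0 \<le> (c - 1) * (c - 1)" by simp
    have S: "y 0 + y 1 + y 2 + y 3 = c - 1"
      and V: "y 1 + (c - 1) * y 2 + c * y 3 = (c - 1) * (c - 1)"
      by (rule degree_and_offset_sum[OF n4 _ _ e _ D]; use c c2 sq V0 in linarith)+
    \<comment> \<open>Reversing the four variables turns offset sum \<open>V\<close> into \<open>c D - V\<close>, here into \<open>c - 1\<close>.\<close>
    have "c * (y 0 + y 1 + y 2 + y 3) - (y 1 + (c - 1) * y 2 + c * y 3) =
        c * (c - 1) - (c - 1) * (c - 1)"
      unfolding S V by simp
    then have "y 2 + (c - 1) * y 1 + c * y 0 = c - 1"
      by (simp add: algebra_simps power2_eq_square)
    moreover have "y 3 + y 2 + y 1 + y 0 = c - 1" using S by simp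
    ultimately show ?thesis
      using pure_power_row_fiber[OF n4(4,3,2,1) c] 2 kc
      by (intro finish) (auto simp: start_point_def end_point_def)
  next
    case 3
    have e: "c\<^sup>2 * y 0 + (c\<^sup>2 + 1) * y 1 + (c\<^sup>2 + c - 1) * y 2 + (c\<^sup>2 + c) * y 3 =
        c\<^sup>2 * 2 + c"
      unfolding eq using 3 by simp
    have D2: "c * (2 - 1) < c\<^sup>2" using c c2 by simp
    have "y 0 + y 1 + y 2 + y 3 = 2" "y 1 + (c - 1) * y 2 + c * y 3 = c"
      by (rule degree_and_offset_sum[OF n4 _ _ e _ D2]; use c c2 in linarith)+
    from quadric_row_fiber[OF n4 c this] show ?thesis
      using 3 by (intro finish) (auto simp: start_point_def end_point_def)
  qed
qed

text \<open>
  Each row offers the two choices of \<open>row_fiber\<close>. If row \<open>0\<close> makes the choice of \<open>end_point\<close>, it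
  uses up the whole column sum \<open>k\<close> of column \<open>0\<close>, so no other row may contain \<open>x\<^sub>0\<close>, and then column
  \<open>3\<close> can only be filled by row \<open>1\<close>; if not, all \<open>k\<close> quadratic rows must contain \<open>x\<^sub>0 x\<^sub>3\<close>, which
  leaves nothing of column \<open>3\<close> for row \<open>1\<close>. Thus no row can be switched alone.
\<close>

lemma two_point_fiber:
  fixes Y :: "nat \<Rightarrow> nat \<Rightarrow> int"
  assumes m: "4 \<le> m" and k: "1 \<le> k" and nonneg: "\<And>i j. i < k + 2 \<Longrightarrow> j < m \<Longrightarrow> 0 \<le> Y i j"
    and rows: "\<And>i. i < k + 2 \<Longrightarrow> (\<Sum>j<m. ((int k + 2)\<^sup>2 + curve_offset k j) * Y i j) =
      (\<Sum>j<m. ((int k + 2)\<^sup>2 + curve_offset k j) * start_point k i j)"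
    and cols: "\<And>j. j < m \<Longrightarrow> (\<Sum>i<k + 2. Y i j) = (\<Sum>i<k + 2. start_point k i j)"
  shows "(\<forall>i<k + 2. \<forall>j<m. Y i j = start_point k i j) \<or>
         (\<forall>i<k + 2. \<forall>j<m. Y i j = end_point k i j)"
proof -
  have tail: "Y i j = 0" if i: "i < k + 2" and j: "4 \<le> j" "j < m" for i j
  proof -
    have "(\<Sum>i<k + 2. Y i j) = 0"
      unfolding cols[OF j(2)] using j by (auto simp: start_point_def)
    then have "\<forall>i\<in>{..<k + 2}. Y i j = 0"
      using nonneg j by (subst sum_nonneg_eq_0_iff[symmetric]) auto
    then show ?thesis using i by simp
  qed
  have row: "(\<forall>j<m. Y i j = start_point k i j) \<or> (\<forall>j<m. Y i j = end_point k i j)"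
    if "i < k + 2" for i
    using row_fiber[OF m k, of "Y i" i] nonneg tail rows that by blast
  have col: "Y 0 j + Y 1 j + (\<Sum>i<k. Y (i + 2) j) = int k" if "j = 0 \<or> j = 3" for j
    using cols[of j, unfolded sum_first_two_rows] that m by (auto simp: start_point_def)
  have quad: "(\<forall>j<m. Y (i + 2) j = start_point k (i + 2) j) \<or>
      (\<forall>j<m. Y (i + 2) j = end_point k (i + 2) j)" if "i < k" for i
    using row that by auto
  have row1: "Y 1 0 = 0"
    using row[of 1] m by (auto simp: start_point_def end_point_def)
  have rows_cases: "i = 0 \<or> i = 1 \<or> (\<exists>i'<k. i = i' + 2)" if "i < k + 2" for i
    using that by (cases i; cases "i - 1") auto
  \<comment> \<open>The choice of row \<open>0\<close> determines those of the quadratic rows, and these that of row \<open>1\<close>.\<close>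
  from row[of 0] consider "\<forall>j<m. Y 0 j = start_point k 0 j" | "\<forall>j<m. Y 0 j = end_point k 0 j"
    by auto
  then show ?thesis
  proof cases
    case 1
    then have "Y 0 0 = 0" "Y 0 3 = 0" using m by (auto simp: start_point_def)
    then have "(\<Sum>i<k. 1 - Y (i + 2) 0) = 0"
      using col[of 0] row1 by (simp add: sum_subtractf)
    moreover have "0 \<le> 1 - Y (i + 2) 0" if "i < k" for i
      using quad[OF that] m by (auto simp: start_point_def end_point_def)
    ultimately have one: "\<forall>i<k. Y (i + 2) 0 = 1"
      by (subst (asm) sum_nonneg_eq_0_iff) auto
    have start: "\<forall>j<m. Y (i + 2) j = start_point k (i + 2) j" if "i < k" for i
      using quad[OF that] one that m by (auto simp: end_point_def)
    then have "(\<Sum>i<k. Y (i + 2) 3) = (\<Sum>i<k. 1)"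
      using m by (intro sum.cong) (auto simp: start_point_def)
    then have "Y 1 3 = 0" using col[of 3] \<open>Y 0 3 = 0\<close> by simp
    then have "\<forall>j<m. Y 1 j = start_point k 1 j"
      using row[of 1] m k by (auto simp: end_point_def)
    then show ?thesis using 1 start rows_cases by blast
  next
    case 2
    then have "Y 0 0 = int k" "Y 0 3 = 0" using m by (auto simp: end_point_def)
    then have "(\<Sum>i<k. Y (i + 2) 0) = 0" using col[of 0] row1 by simp
    moreover have "0 \<le> Y (i + 2) 0" if "i < k" for i
      using nonneg that m by simp
    ultimately have zero: "\<forall>i<k. Y (i + 2) 0 = 0"
      by (subst (asm) sum_nonneg_eq_0_iff) auto
    have "end": "\<forall>j<m. Y (i + 2) j = end_point k (i + 2) j" if "i < k" for i
      using quad[OF that] zero that m by (auto simp: start_point_def)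
    then have "(\<Sum>i<k. Y (i + 2) 3) = (\<Sum>i<k. 0)"
      using m by (intro sum.cong) (auto simp: end_point_def)
    then have "Y 1 3 = int k" using col[of 3] \<open>Y 0 3 = 0\<close> by simp
    then have "\<forall>j<m. Y 1 j = end_point k 1 j"
      using row[of 1] m k by (auto simp: start_point_def)
    then show ?thesis using 2 "end" rows_cases by blast
  qed
qed

section \<open>Large Markov complexity\<close>

definition block_vec :: "nat \<Rightarrow> nat \<Rightarrow> (nat \<Rightarrow> nat \<Rightarrow> int) \<Rightarrow> int vec" where
  "block_vec r n Y = vec (r * n) (\<lambda>l. Y (l div n) (l mod n))"

lemma block_index_less:
  fixes i j n r :: nat
  assumes "i < r" and "j < n"
  shows "i * n + j < r * n"
proof -
  have "i * n + j < Suc i * n" using assms by simp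
  also have "\<dots> \<le> r * n" using assms by (intro mult_right_mono) auto
  finally show ?thesis .
qed

lemma block_vec_nonneg:
  assumes "\<And>i j. 0 \<le> Y i j"
  shows "block_vec r n Y \<in> nonneg_vecs (r * n)"
  using assms by (simp add: block_vec_def nonneg_vecs_def)

lemma block_vec_eqI:
  assumes v: "v \<in> carrier_vec (r * n)"
    and "\<forall>i<r. \<forall>j<n. v $ (i * n + j) = Y i j"
  shows "v = block_vec r n Y"
proof (rule eq_vecI)
  show "dim_vec v = dim_vec (block_vec r n Y)" using v by (simp add: block_vec_def)
  fix l assume "l < dim_vec (block_vec r n Y)"
  then have l: "l < r * n" by (simp add: block_vec_def)
  then have "0 < n" by (cases n) auto
  then have "v $ (l div n * n + l mod n) = Y (l div n) (l mod n)"
    using assms(2)[rule_format, of "l div n" "l mod n"] less_mult_imp_div_less[OF l] by simp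
  then show "v $ l = block_vec r n Y $ l" using l by (simp add: block_vec_def)
qed

lemma curve_matrix_carrier: "curve_matrix as \<in> carrier_mat 1 (length as)"
  by (simp add: curve_matrix_def mat_of_rows_list_def)

lemma curve_matrix_kernel:
  assumes "v \<in> carrier_vec (length as)"
  shows "v \<in> mat_kernel (curve_matrix as) \<longleftrightarrow> (\<Sum>j<length as. as ! j * v $ j) = 0"
proof -
  have "(curve_matrix as *\<^sub>v v) $ 0 = (\<Sum>j<length as. as ! j * v $ j)"
    using assms
    by (simp add: curve_matrix_def mat_of_rows_list_def scalar_prod_def lessThan_atLeast0)
  moreover have "curve_matrix as *\<^sub>v v = 0\<^sub>v 1 \<longleftrightarrow> (curve_matrix as *\<^sub>v v) $ 0 = 0"
    using curve_matrix_carrier[of as] by (auto simp: vec_eq_iff)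
  ultimately show ?thesis
    using assms curve_matrix_carrier[of as] by (simp add: mat_kernel_def)
qed

lemma block_vec_minus_kernel:
  assumes y: "y \<in> carrier_vec (r * n)" and n: "length as = n"
  shows "block_vec r n X - y \<in> mat_kernel (lawrence_lifting r (curve_matrix as)) \<longleftrightarrow>
    (\<forall>i<r. (\<Sum>j<n. as ! j * y $ (i * n + j)) = (\<Sum>j<n. as ! j * X i j)) \<and>
    (\<forall>j<n. (\<Sum>i<r. y $ (i * n + j)) = (\<Sum>i<r. X i j))"
proof -
  let ?v = "block_vec r n X - y"
  have entry: "block_row n ?v i $ j = X i j - y $ (i * n + j)" if "i < r" "j < n" for i j
    using that y block_index_less[OF that] by (simp add: block_row_def block_vec_def)
  have rows: "block_row n ?v i \<in> mat_kernel (curve_matrix as) \<longleftrightarrow>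
      (\<Sum>j<n. as ! j * y $ (i * n + j)) = (\<Sum>j<n. as ! j * X i j)" if "i < r" for i
  proof -
    have "(\<Sum>j<n. as ! j * block_row n ?v i $ j) =
        (\<Sum>j<n. as ! j * X i j) - (\<Sum>j<n. as ! j * y $ (i * n + j))"
      using that by (simp add: entry sum_subtractf[symmetric] algebra_simps)
    moreover have "block_row n ?v i \<in> carrier_vec n" by (simp add: block_row_def)
    ultimately show ?thesis using curve_matrix_kernel[of "block_row n ?v i" as] n by auto
  qed
  have columns: "(\<Sum>i<r. block_row n ?v i $ j) = 0 \<longleftrightarrow>
      (\<Sum>i<r. y $ (i * n + j)) = (\<Sum>i<r. X i j)" if "j < n" for j
  proof -
    have "(\<Sum>i<r. block_row n ?v i $ j) = (\<Sum>i<r. X i j) - (\<Sum>i<r. y $ (i * n + j))"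
      using that by (simp add: entry sum_subtractf[symmetric])
    then show ?thesis by auto
  qed
  have "?v \<in> mat_kernel (lawrence_lifting r (curve_matrix as)) \<longleftrightarrow>
      (\<forall>i<r. block_row n ?v i \<in> mat_kernel (curve_matrix as)) \<and>
      (\<forall>j<n. (\<Sum>i<r. block_row n ?v i $ j) = 0)"
    unfolding lawrence_lifting_kernel[OF curve_matrix_carrier] n
    using y by (simp add: block_vec_def)
  then show ?thesis using rows columns by blast
qed

lemma lawrence_type_full:
  assumes "\<And>i. i < r \<Longrightarrow> \<exists>j<n. v $ (i * n + j) \<noteq> 0"
  shows "lawrence_type r n v = r"
proof -
  have "block_row n v i \<noteq> 0\<^sub>v n" if "i < r" for i
  proof
    assume eq: "block_row n v i = 0\<^sub>v n"
    have "v $ (i * n + j) = 0" if "j < n" for j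
      using arg_cong[OF eq, of "\<lambda>z. z $ j"] that by (simp add: block_row_def)
    then show False using assms[OF that] by auto
  qed
  then have "{i. i < r \<and> block_row n v i \<noteq> 0\<^sub>v n} = {..<r}" by auto
  then show ?thesis by (simp add: lawrence_type_def)
qed

lemma wide_curve_markov_complexity:
  assumes m: "4 \<le> m" and k: "1 \<le> k"
  shows "enat (k + 2) \<le> markov_complexity (wide_curve k m)"
proof -
  let ?as = "wide_curve k m" and ?r = "k + 2"
  let ?L = "lawrence_lifting ?r (curve_matrix ?as)"
  define w where "w = block_vec ?r m (start_point k)"
  define u where "u = block_vec ?r m (end_point k)"
  have len: "length ?as = m" by (simp add: wide_curve_def)
  have nth: "?as ! j = (int k + 2)\<^sup>2 + curve_offset k j" if "j < m" for j
    using that by (simp add: wide_curve_def)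
  have dim: "dim_col ?L = ?r * m"
    using lawrence_lifting_carrier[OF curve_matrix_carrier, of ?r ?as] len by simp
  have w: "w \<in> nonneg_vecs (?r * m)" and u: "u \<in> nonneg_vecs (?r * m)"
    unfolding w_def u_def by (intro block_vec_nonneg; simp add: start_point_def end_point_def)+
  have uc: "u \<in> carrier_vec (?r * m)" using u by (simp add: nonneg_vecs_def)
  have entries: "w $ (i * m + j) = start_point k i j" "u $ (i * m + j) = end_point k i j"
    if "i < ?r" "j < m" for i j
    using that block_index_less[OF that] by (simp_all add: w_def u_def block_vec_def)
  have kernel: "w - u \<in> mat_kernel ?L"
    unfolding w_def block_vec_minus_kernel[OF uc len]
    using row_degree_end_point[OF m, of "(int k + 2)\<^sup>2" k] column_sum_end_point[of k]
    by (simp add: entries nth)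
  have differ: "(w - u) $ (i * m) \<noteq> 0 \<or> (w - u) $ (i * m + 3) \<noteq> 0" if "i < ?r" for i
    using that m k entries[of i 0] entries[of i 3] uc
      block_index_less[of i ?r 0 m] block_index_less[of i ?r 3 m]
    by (auto simp: start_point_def end_point_def split: if_splits)
  have "w \<noteq> u"
    using entries[of 0 0] m k by (auto simp: start_point_def end_point_def)
  moreover have "y = w \<or> y = u"
    if y: "y \<in> nonneg_vecs (?r * m)" and wy: "w - y \<in> mat_kernel ?L" for y
  proof -
    have yc: "y \<in> carrier_vec (?r * m)" using y by (simp add: nonneg_vecs_def)
    have "(\<forall>i<?r. \<forall>j<m. y $ (i * m + j) = start_point k i j) \<or>
        (\<forall>i<?r. \<forall>j<m. y $ (i * m + j) = end_point k i j)"
    proof (rule two_point_fiber[OF m k])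
      show "0 \<le> y $ (i * m + j)" if "i < ?r" "j < m" for i j
        using y block_index_less[OF that] by (simp add: nonneg_vecs_def)
    qed (use wy[unfolded w_def block_vec_minus_kernel[OF yc len]] nth in auto)
    then show ?thesis
      unfolding w_def u_def using block_vec_eqI[OF yc] by blast
  qed
  ultimately have "w - u \<in> universal_markov_basis ?L \<or> - (w - u) \<in> universal_markov_basis ?L"
    using w u kernel two_point_fiber_indispensable[of w ?L u, unfolded dim] by blast
  moreover have "lawrence_type ?r m (w - u) = ?r" "lawrence_type ?r m (- (w - u)) = ?r"
  proof -
    have "\<exists>j<m. (w - u) $ (i * m + j) \<noteq> 0 \<and> (- (w - u)) $ (i * m + j) \<noteq> 0" if "i < ?r" for i
      using differ[OF that] m uc block_index_less[OF that, of 0 m] block_index_less[OF that, of 3 m]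
      by (elim disjE) (rule exI[of _ 0], force, rule exI[of _ 3], force)
    then show "lawrence_type ?r m (w - u) = ?r" "lawrence_type ?r m (- (w - u)) = ?r"
      by (intro lawrence_type_full; blast)+
  qed
  ultimately obtain v where v: "v \<in> universal_markov_basis ?L" "lawrence_type ?r m v = ?r"
    by blast
  have "enat ?r \<le> (SUP v \<in> universal_markov_basis ?L. enat (lawrence_type ?r (length ?as) v))"
    using v len by (intro SUP_upper2[of v]) auto
  also have "\<dots> \<le> markov_complexity ?as"
    unfolding markov_complexity_def by (rule SUP_upper) simp
  finally show ?thesis .
qed

theorem corollary4p4:
  fixes m d :: nat
  assumes "m \<ge> 4"
  shows "\<exists>as :: int list. monomial_curve m as \<and> markov_complexity as > enat d"
proof (intro exI conjI)
  show "monomial_curve m (wide_curve (d + 1) m)" by (intro monomial_curve_wide_curve) simp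
  \<comment> \<open>The type is \<open>k + 2\<close>; taking \<open>k = d + 1\<close> also meets the requirement \<open>1 \<le> k\<close>.\<close>
  have "enat d < enat (d + 1 + 2)" by simp
  also have "\<dots> \<le> markov_complexity (wide_curve (d + 1) m)"
    using assms by (intro wide_curve_markov_complexity) auto
  finally show "enat d < markov_complexity (wide_curve (d + 1) m)" .
qed

end
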